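(* Let $(S,+)$ be a discrete commutative semigroup, let $\mathcal{A}\subseteq\mathcal{P}(S)$, let $u,v\in\mathbb{N}$, and let $M$ be a $u\times v$ matrix with entries from $\omega=\{0,1,2,\dots\}$ satisfying the first entries condition. Assume: (1) $\mathcal{A}\neq\emptyset$ and $\emptyset\notin\mathcal{A}$; (2) for all $A,B\in\mathcal{A}$, $A\cap B\in\mathcal{A}$; (3) for all $A\in\mathcal{A}$ and $a\in A$ there is $B\in\mathcal{A}$ with $a+B\subseteq A$; (4) for all $A\in\mathcal{A}$ there is $B\in\mathcal{A}$ with $B+B\subseteq A$. Let $T=\bigcap_{A\in\mathcal{A}}\mathrm{cl}(A)$. Then $T$ is a subsemigroup of $\beta S_d$. Moreover, if $p$ is an idempotent in $K(T)\cap\bigcap_{A\in\mathcal{A}}\bigcap_{c\in P(M)}\mathrm{cl}(cA)$ and $(C_n)_{n\in\mathbb{N}}$ are subsets of $S$ with $C_n\in p$ for all $n\in\mathbb{N}$, then for every $A\in\mathcal{A}$ there exist sequences $(x_{1,n})_{n\in\mathbb{N}},\dots,(x_{v,n})_{n\in\mathbb{N}}$ in $A$ such that for every $F\in\mathcal{P}_f(\mathbb{N})$ with $\min F=r$, \[M\vec{x}_F\in (C_r)^u,\qquad \vec{x}_F=\begin{pmatrix}\sum_{n\in F}x_{1,n}\\ \vdots\\ \sum_{n\in F}x_{v,n}\end{pmatrix}.\]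
   Context: $S_d$ is $S$ with the discrete topology; $\beta S_d$ is its Stone–Čech compactification (ultrafilters on $S$) with the usual extension of $+$; $\mathrm{cl}(A)=\{q\in\beta S_d: A\in q\}$; $K(T)$ is the smallest ideal of the compact right topological semigroup $T$. $\mathcal{P}_f(\mathbb{N})$ is the set of finite nonempty subsets of $\mathbb{N}$. A matrix satisfies the first entries condition if no row is zero and whenever two rows have their first nonzero entries in the same column those entries are equal; $P(M)$ is the set of these first entries of $M$. For $c\in\mathbb{N}$ and $a\in S$, $ca$ denotes $a+\cdots+a$ ($c$ times), and $cA=\{ca:a\in A\}$; matrix–vector products are computed with this meaning of $ca$. *)

theory Defs
  imports
    "HOL-Library.Set_Algebras"
    "Jordan_Normal_Form.Matrix"
begin

text \<open>Points of the Stone-Cech compactification of the discrete space \<open>'a\<close>.\<close>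

typedef 'a ultrafilter =
  "{F :: 'a filter. F \<noteq> bot \<and> (\<forall>P. eventually P F \<or> eventually (\<lambda>x. \<not> P x) F)}"
  morphisms filter_of Abs_ultrafilter
proof
  show "principal {undefined} \<in>
      {F :: 'a filter. F \<noteq> bot \<and> (\<forall>P. eventually P F \<or> eventually (\<lambda>x. \<not> P x) F)}"
    by (simp add: eventually_principal principal_eq_bot_iff)
qed

setup_lifting type_definition_ultrafilter

definition in_uf :: "'a set \<Rightarrow> 'a ultrafilter \<Rightarrow> bool" (infix \<open>\<in>\<^sub>u\<close> 50) where
  "A \<in>\<^sub>u q \<longleftrightarrow> eventually (\<lambda>x. x \<in> A) (filter_of q)"

definition cl :: "'a set \<Rightarrow> 'a ultrafilter set" where
  "cl A = {q. A \<in>\<^sub>u q}"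

lemma in_uf_Compl_iff: "- A \<in>\<^sub>u q \<longleftrightarrow> \<not> A \<in>\<^sub>u q"
proof -
  have nb: "filter_of q \<noteq> bot"
    and ult: "eventually (\<lambda>x. x \<in> A) (filter_of q) \<or> eventually (\<lambda>x. x \<notin> A) (filter_of q)"
    using filter_of[of q] by auto
  have "\<not> (eventually (\<lambda>x. x \<in> A) (filter_of q) \<and> eventually (\<lambda>x. x \<notin> A) (filter_of q))"
    using eventually_conj[of "\<lambda>x. x \<in> A" "filter_of q" "\<lambda>x. x \<notin> A"] nb
    by (auto simp: trivial_limit_def)
  with ult show ?thesis by (auto simp: in_uf_def)
qed

lemma is_filter_plus:
  fixes F G :: "'a::plus filter"
  shows "is_filter (\<lambda>P. eventually (\<lambda>x. eventually (\<lambda>y. P (x + y)) G) F)"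
proof
  fix P Q :: "'a \<Rightarrow> bool"
  assume P: "eventually (\<lambda>x. eventually (\<lambda>y. P (x + y)) G) F"
  show "eventually (\<lambda>x. eventually (\<lambda>y. Q (x + y)) G) F" if "\<forall>x. P x \<longrightarrow> Q x"
    using P by (rule eventually_mono) (use that in \<open>auto elim: eventually_mono\<close>)
qed (simp_all add: eventually_conj_iff)

text \<open>The extension of \<open>+\<close> making \<open>p \<mapsto> p + q\<close> continuous for each \<open>q\<close>:
  \<open>A \<in> p + q\<close> iff \<open>{x. {y. x + y \<in> A} \<in> q} \<in> p\<close>; see \<open>in_uf_plus_iff\<close>.\<close>

instantiation ultrafilter :: (plus) plus
begin

lift_definition plus_ultrafilter :: "'a ultrafilter \<Rightarrow> 'a ultrafilter \<Rightarrow> 'a ultrafilter"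
  is "\<lambda>F G. Abs_filter (\<lambda>P. eventually (\<lambda>x. eventually (\<lambda>y. P (x + y)) G) F)"
proof -
  fix F G :: "'a filter"
  assume F: "F \<noteq> bot \<and> (\<forall>P. eventually P F \<or> eventually (\<lambda>x. \<not> P x) F)"
    and G: "G \<noteq> bot \<and> (\<forall>P. eventually P G \<or> eventually (\<lambda>x. \<not> P x) G)"
  let ?H = "Abs_filter (\<lambda>P. eventually (\<lambda>x. eventually (\<lambda>y. P (x + y)) G) F)"
  have ev: "eventually P ?H \<longleftrightarrow> eventually (\<lambda>x. eventually (\<lambda>y. P (x + y)) G) F" for P
    by (rule eventually_Abs_filter[OF is_filter_plus])
  have "?H \<noteq> bot"
    using F G by (simp add: trivial_limit_def ev)
  moreover have "eventually P ?H \<or> eventually (\<lambda>x. \<not> P x) ?H" for P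
  proof (cases "eventually (\<lambda>x. eventually (\<lambda>y. P (x + y)) G) F")
    case False
    then have "eventually (\<lambda>x. \<not> eventually (\<lambda>y. P (x + y)) G) F"
      using F by blast
    then have "eventually (\<lambda>x. eventually (\<lambda>y. \<not> P (x + y)) G) F"
      by (rule eventually_mono) (use G in blast)
    then show ?thesis by (simp add: ev)
  qed (simp add: ev)
  ultimately show "?H \<noteq> bot \<and> (\<forall>P. eventually P ?H \<or> eventually (\<lambda>x. \<not> P x) ?H)"
    by blast
qed

instance ..

end

lemma in_uf_plus_iff: "A \<in>\<^sub>u p + q \<longleftrightarrow> {x. {y. x + y \<in> A} \<in>\<^sub>u q} \<in>\<^sub>u p"
  by (simp add: in_uf_def plus_ultrafilter.rep_eq eventually_Abs_filter[OF is_filter_plus])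

instance ultrafilter :: (semigroup_add) semigroup_add
proof
  fix p q r :: "'a ultrafilter"
  have "filter_of (p + q + r) = filter_of (p + (q + r))"
    by (simp add: filter_eq_iff plus_ultrafilter.rep_eq
        eventually_Abs_filter[OF is_filter_plus] add.assoc)
  then show "p + q + r = p + (q + r)"
    by (simp add: filter_of_inject)
qed

definition subsemigroup :: "'a::plus set \<Rightarrow> bool" where
  "subsemigroup T \<longleftrightarrow> T \<noteq> {} \<and> T + T \<subseteq> T"

definition semigroup_ideal :: "'a::plus set \<Rightarrow> 'a set \<Rightarrow> bool" where
  "semigroup_ideal T I \<longleftrightarrow> I \<noteq> {} \<and> I \<subseteq> T \<and> T + I \<subseteq> I \<and> I + T \<subseteq> I"

text \<open>The smallest two-sided ideal of \<open>T\<close>, if there is one.\<close>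

definition smallest_ideal :: "'a::plus set \<Rightarrow> 'a set" where
  "smallest_ideal T = \<Inter> {I. semigroup_ideal T I}"

lemma smallest_ideal_eqI:
  assumes "semigroup_ideal T I" "\<And>J. semigroup_ideal T J \<Longrightarrow> I \<subseteq> J"
  shows "smallest_ideal T = I"
  using assms unfolding smallest_ideal_def by blast

text \<open>Sums over finite nonempty index sets. A semigroup need not have a neutral element,
  so \<^const>\<open>sum\<close> is not applicable; see \<open>ssum_eq_sum\<close> for the relation.\<close>

definition ssum :: "('i::linorder \<Rightarrow> 'a::ab_semigroup_add) \<Rightarrow> 'i set \<Rightarrow> 'a" where
  "ssum f F = Finite_Set.fold (\<lambda>i s. f i + s) (f (Min F)) (F - {Min F})"

lemma ssum_singleton: "ssum f {i} = f i"
  by (simp add: ssum_def)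

lemma comp_fun_commute_ssum: "comp_fun_commute (\<lambda>i s. f i + (s::'a::ab_semigroup_add))"
  by standard (simp add: fun_eq_iff add.left_commute)

lemma ssum_insert:
  assumes "finite F" "F \<noteq> {}" "i \<notin> F"
  shows "ssum f (insert i F) = f i + ssum f F"
proof -
  interpret comp_fun_commute "\<lambda>i s. f i + s"
    by (rule comp_fun_commute_ssum)
  have swap: "Finite_Set.fold (\<lambda>i s. f i + s) (a + b) G =
      a + Finite_Set.fold (\<lambda>i s. f i + s) b G" if "finite G" for a b G
    using that by (induction G) (simp_all add: add.left_commute)
  define m where "m = Min F"
  have m: "m \<in> F" using assms by (simp add: m_def)
  show ?thesis
  proof (cases "i < m")
    case True
    then have min: "Min (insert i F) = i" using assms by (simp add: m_def)
    have "ssum f (insert i F) = Finite_Set.fold (\<lambda>i s. f i + s) (f i) F"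
      using assms by (simp add: ssum_def min)
    also have "\<dots> = Finite_Set.fold (\<lambda>i s. f i + s) (f i) (insert m (F - {m}))"
      using m by (simp add: insert_absorb)
    also have "\<dots> = f m + Finite_Set.fold (\<lambda>i s. f i + s) (f i) (F - {m})"
      by (rule fold_insert) (use assms in auto)
    also have "\<dots> = f i + Finite_Set.fold (\<lambda>i s. f i + s) (f m) (F - {m})"
      using assms swap[of "F - {m}" "f m" "f i"] swap[of "F - {m}" "f i" "f m"]
      by (simp add: add.commute[of "f m" "f i"])
    finally show ?thesis by (simp add: ssum_def m_def)
  next
    case False
    then have min: "Min (insert i F) = m" using assms
      by (simp add: m_def del: Min_gr_iff)
    have "insert i F - {m} = insert i (F - {m})" using assms m by blast
    then show ?thesis using assms by (simp add: ssum_def min m_def[symmetric])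
  qed
qed

lemma ssum_eq_sum:
  fixes f :: "'i::linorder \<Rightarrow> 'a::comm_monoid_add"
  assumes "finite F" "F \<noteq> {}"
  shows "ssum f F = sum f F"
  using assms by (induction rule: finite_ne_induct) (simp_all add: ssum_singleton ssum_insert)

text \<open>\<open>nmult c a = a + \<dots> + a\<close> with \<open>c\<close> summands, meaningful for \<open>c > 0\<close> only.\<close>

definition nmult :: "nat \<Rightarrow> 'a::plus \<Rightarrow> 'a" where
  "nmult c a = ((+) a ^^ (c - 1)) a"

lemma nmult_1: "nmult 1 a = a"
  and nmult_Suc: "c > 0 \<Longrightarrow> nmult (Suc c) a = a + nmult c a"
  by (cases c; simp add: nmult_def)+

text \<open>Matrix-vector product over a semigroup: the terms with coefficient \<open>0\<close> are omitted,
  which is meaningful as long as no row of the matrix is zero.\<close>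

definition mat_vec :: "nat mat \<Rightarrow> 'a::ab_semigroup_add vec \<Rightarrow> 'a vec" where
  "mat_vec M x = vec (dim_row M)
     (\<lambda>i. ssum (\<lambda>j. nmult (M $$ (i, j)) (x $ j)) {j. j < dim_col M \<and> M $$ (i, j) \<noteq> 0})"

definition first_col :: "nat mat \<Rightarrow> nat \<Rightarrow> nat" where
  "first_col M i = (LEAST j. j < dim_col M \<and> M $$ (i, j) \<noteq> 0)"

definition first_entry :: "nat mat \<Rightarrow> nat \<Rightarrow> nat" where
  "first_entry M i = M $$ (i, first_col M i)"

definition first_entries_condition :: "nat mat \<Rightarrow> bool" where
  "first_entries_condition M \<longleftrightarrow>
     (\<forall>i < dim_row M. \<exists>j < dim_col M. M $$ (i, j) \<noteq> 0) \<and>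
     (\<forall>i < dim_row M. \<forall>k < dim_row M.
        first_col M i = first_col M k \<longrightarrow> first_entry M i = first_entry M k)"

definition first_entries :: "nat mat \<Rightarrow> nat set" where
  "first_entries M = first_entry M ` {..<dim_row M}"

text \<open>The set of vectors of length \<open>u\<close> with all entries in \<open>C\<close>.\<close>

definition vec_power :: "'a set \<Rightarrow> nat \<Rightarrow> 'a vec set" where
  "vec_power C u = {w \<in> carrier_vec u. vec_set w \<subseteq> C}"

end

theory Submission
  imports Defs "HOL-Library.Function_Algebras"
begin

text \<open>Instead of the sequences one constructs an idempotent ultrafilter \<open>r\<close> on vectors \<open>x\<close>, all of
  whose coordinates lie in \<open>T\<close> and whose images under all rows of \<open>M\<close> are equal to \<open>p\<close>; the sequences
  are then read off \<open>r\<close> by the Galvin-Glazer argument. By compactness such an \<open>r\<close> exists as soon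
  as for all \<open>A \<in> \<A>\<close> and \<open>C \<in> p\<close> there is a single \<open>x \<in> A\<^sup>v\<close> with \<open>M x \<in> C\<^sup>u\<close>. The latter is
  proved by adding the columns of \<open>M\<close> from right to left. In a row with first entry \<open>c\<close> in the new
  column, the columns to its right contribute a linear form \<open>f\<^sub>i\<close> evaluated at some \<open>w\<close> drawn from the
  idempotent obtained before, and since \<open>p\<close> is minimal in \<open>T\<close>, there are \<open>a \<in> C \<inter> cA\<close> and \<open>w\<close>
  such that all \<open>a + f\<^sub>i w\<close> are in \<open>C\<close>.\<close>

section \<open>The space of ultrafilters\<close>

lemma in_uf_UNIV [simp]: "UNIV \<in>\<^sub>u q"
  by (simp add: in_uf_def)

lemma not_in_uf_empty [simp]: "\<not> {} \<in>\<^sub>u q"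
  using in_uf_Compl_iff[of UNIV q] by simp

lemma in_uf_mono: "A \<in>\<^sub>u q \<Longrightarrow> A \<subseteq> B \<Longrightarrow> B \<in>\<^sub>u q"
  unfolding in_uf_def by (erule eventually_mono) blast

lemma in_uf_Int_iff: "A \<inter> B \<in>\<^sub>u q \<longleftrightarrow> A \<in>\<^sub>u q \<and> B \<in>\<^sub>u q"
  by (simp add: in_uf_def eventually_conj_iff)

lemma in_uf_INT: "finite J \<Longrightarrow> (\<And>j. j \<in> J \<Longrightarrow> A j \<in>\<^sub>u q) \<Longrightarrow> (\<Inter>j\<in>J. A j) \<in>\<^sub>u q"
  by (induction J rule: finite_induct) (simp_all add: in_uf_Int_iff)

lemma in_uf_nonempty: "A \<in>\<^sub>u q \<Longrightarrow> \<exists>x. x \<in> A"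
  using not_in_uf_empty by (metis all_not_in_conv)

text \<open>One inclusion suffices, because ultrafilters are maximal: the hypothesis can also be
  applied to \<open>- A\<close>.\<close>

lemma ultrafilter_eqI:
  assumes "\<And>A. A \<in>\<^sub>u p \<Longrightarrow> A \<in>\<^sub>u q"
  shows "p = q"
proof -
  have "A \<in>\<^sub>u p \<longleftrightarrow> A \<in>\<^sub>u q" for A
    using assms[of A] assms[of "- A"] by (auto simp: in_uf_Compl_iff)
  from this[of "Collect P" for P] have "eventually P (filter_of p) \<longleftrightarrow> eventually P (filter_of q)" for P
    by (simp add: in_uf_def)
  then show ?thesis
    by (simp add: filter_eq_iff flip: filter_of_inject)
qed

text \<open>Zorn's lemma: smaller filters are finer, so a proper filter that is minimal below
  \<open>F\<close> is an ultrafilter. The infimum of a nonempty chain of proper filters is proper,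
  since the chain is a base of it.\<close>

lemma ex_ultrafilter_le:
  assumes "F \<noteq> bot"
  shows "\<exists>q. filter_of q \<le> F"
proof -
  define N where "N = {G. G \<noteq> bot \<and> G \<le> F}"
  have "\<exists>m\<in>N. \<forall>a\<in>N. m \<ge> a \<longrightarrow> a = m"
  proof (rule predicate_Zorn)
    show "partial_order_on N (relation_of (\<ge>) N)"
      by (auto simp: partial_order_on_def preorder_on_def refl_on_def trans_def antisym_def
          relation_of_def)
  next
    fix C assume "C \<in> Chains (relation_of (\<ge>) N)"
    then have sub: "C \<subseteq> N" and chain: "\<And>G H. G \<in> C \<Longrightarrow> H \<in> C \<Longrightarrow> G \<le> H \<or> H \<le> G"
      by (auto simp: Chains_def relation_of_def)
    show "\<exists>u\<in>N. \<forall>a\<in>C. a \<ge> u"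
    proof (cases "C = {}")
      case True
      then show ?thesis using assms by (auto simp: N_def)
    next
      case False
      have "eventually P (Inf C) \<longleftrightarrow> (\<exists>b\<in>C. eventually P b)" for P
        by (rule eventually_Inf_base[OF False]) (use chain in \<open>auto simp: inf_absorb1 inf_absorb2\<close>)
      then have "Inf C \<noteq> bot"
        using sub by (auto simp: trivial_limit_def N_def)
      moreover from False obtain G where "G \<in> C" by blast
      then have "Inf C \<le> F"
        using sub by (intro order_trans[OF Inf_lower]) (auto simp: N_def)
      ultimately show ?thesis
        by (auto simp: N_def intro: Inf_lower)
    qed
  qed
  then obtain m where m: "m \<noteq> bot" "m \<le> F" "\<And>G. G \<noteq> bot \<Longrightarrow> G \<le> F \<Longrightarrow> G \<le> m \<Longrightarrow> G = m"
    by (auto simp: N_def)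
  have "eventually P m \<or> eventually (\<lambda>x. \<not> P x) m" for P
  proof (rule disjCI)
    \<comment> \<open>Restricting \<open>m\<close> to \<open>P\<close> then leaves a proper filter,
      which by minimality is \<open>m\<close> itself.\<close>
    assume "\<not> eventually (\<lambda>x. \<not> P x) m"
    then have "inf m (principal (Collect P)) \<noteq> bot"
      by (simp add: trivial_limit_def eventually_inf_principal)
    then have "inf m (principal (Collect P)) = m"
      using m(2) by (intro m(3)) (auto intro: le_infI1)
    then show "eventually P m"
      using eventually_inf_principal[of P m "Collect P"] by simp
  qed
  then have "filter_of (Abs_ultrafilter m) = m"
    using m(1) by (intro Abs_ultrafilter_inverse) simp
  then show ?thesis using m(2) by metis
qed

lemma ex_ultrafilter:
  assumes "\<B> \<noteq> {}" "{} \<notin> \<B>" "\<And>A B. A \<in> \<B> \<Longrightarrow> B \<in> \<B> \<Longrightarrow> \<exists>C\<in>\<B>. C \<subseteq> A \<inter> B"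
  shows "\<exists>q. \<forall>A\<in>\<B>. A \<in>\<^sub>u q"
proof -
  define F where "F = (INF A\<in>\<B>. principal A)"
  have ev: "eventually P F \<longleftrightarrow> (\<exists>A\<in>\<B>. eventually P (principal A))" for P
    unfolding F_def by (rule eventually_INF_base) (use assms in auto)
  then have "F \<noteq> bot"
    using assms(2) by (auto simp: trivial_limit_def eventually_principal)
  then obtain q where "filter_of q \<le> F"
    using ex_ultrafilter_le by blast
  moreover have "eventually (\<lambda>x. x \<in> A) F" if "A \<in> \<B>" for A
    using that by (auto simp: ev eventually_principal)
  ultimately have "A \<in>\<^sub>u q" if "A \<in> \<B>" for A
    using that by (simp add: in_uf_def le_filter_def)
  then show ?thesis by blast
qed

section \<open>The Stone topology: compact, Hausdorff, with addition continuous in its left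
  argument\<close>

instantiation ultrafilter :: (type) topological_space
begin

text \<open>The sets \<open>cl A\<close> are a base of this topology. They are clopen because
  complements are respected by ultrafilters.\<close>

definition open_ultrafilter :: "'a ultrafilter set \<Rightarrow> bool" where
  "open_ultrafilter U \<longleftrightarrow> (\<forall>q\<in>U. \<exists>A. A \<in>\<^sub>u q \<and> cl A \<subseteq> U)"

instance
proof
  fix U V :: "'a ultrafilter set"
  assume UV: "open U" "open V"
  show "open (U \<inter> V)"
    unfolding open_ultrafilter_def
  proof
    fix q assume "q \<in> U \<inter> V"
    then obtain A B where "A \<in>\<^sub>u q" "cl A \<subseteq> U" "B \<in>\<^sub>u q" "cl B \<subseteq> V"
      using UV unfolding open_ultrafilter_def by blast
    then show "\<exists>A. A \<in>\<^sub>u q \<and> cl A \<subseteq> U \<inter> V"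
      by (intro exI[of _ "A \<inter> B"]) (auto simp: cl_def in_uf_Int_iff)
  qed
next
  fix K :: "'a ultrafilter set set"
  assume K: "\<forall>U\<in>K. open U"
  show "open (\<Union>K)"
    unfolding open_ultrafilter_def
  proof
    fix q assume "q \<in> \<Union>K"
    then obtain U where "U \<in> K" "q \<in> U" by blast
    with K obtain A where "A \<in>\<^sub>u q" "cl A \<subseteq> U" unfolding open_ultrafilter_def by blast
    then show "\<exists>A. A \<in>\<^sub>u q \<and> cl A \<subseteq> \<Union>K" using \<open>U \<in> K\<close> by blast
  qed
qed (auto simp: open_ultrafilter_def intro: in_uf_UNIV)

end

lemma open_cl: "open (cl A)"
  by (auto simp: open_ultrafilter_def cl_def)

lemma closed_cl: "closed (cl A)"
proof -
  have "- cl A = cl (- A)" by (auto simp: cl_def in_uf_Compl_iff)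
  then show ?thesis by (simp add: closed_def open_cl)
qed

instance ultrafilter :: (type) t2_space
proof
  fix p q :: "'a ultrafilter"
  assume "p \<noteq> q"
  then obtain A where "A \<in>\<^sub>u p" "\<not> A \<in>\<^sub>u q" using ultrafilter_eqI by blast
  then have "open (cl A) \<and> open (cl (- A)) \<and> p \<in> cl A \<and> q \<in> cl (- A) \<and> cl A \<inter> cl (- A) = {}"
    by (intro conjI open_cl) (auto simp: cl_def in_uf_Compl_iff)
  then show "\<exists>U V. open U \<and> open V \<and> p \<in> U \<and> q \<in> V \<and> U \<inter> V = {}" by blast
qed

lemma compact_UNIV_ultrafilter: "compact (UNIV :: 'a ultrafilter set)"
  unfolding compact_fip
proof (intro allI impI)
  fix \<F> :: "'a ultrafilter set set"
  assume closed: "\<forall>X\<in>\<F>. closed X"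
    and fip: "\<forall>\<G>\<subseteq>\<F>. finite \<G> \<longrightarrow> UNIV \<inter> \<Inter>\<G> \<noteq> {}"
  \<comment> \<open>An ultrafilter containing this filter base is the desired common point: it lies
    in every \<open>cl A\<close> around a finite intersection from \<open>\<F>\<close>, and closed
    sets are intersections of such clopen sets.\<close>
  define \<Z> where "\<Z> = {A. \<exists>\<G>\<subseteq>\<F>. finite \<G> \<and> \<Inter>\<G> \<subseteq> cl A}"
  have "\<exists>q. \<forall>A\<in>\<Z>. A \<in>\<^sub>u q"
  proof (rule ex_ultrafilter)
    have "UNIV \<in> \<Z>"
      by (auto simp: \<Z>_def cl_def intro!: exI[of _ "{}"])
    then show "\<Z> \<noteq> {}" by blast
    show "{} \<notin> \<Z>"
    proof
      assume "{} \<in> \<Z>"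
      then obtain \<G> where \<G>: "\<G> \<subseteq> \<F>" "finite \<G>" "\<Inter>\<G> \<subseteq> cl {}"
        by (auto simp: \<Z>_def)
      have "cl {} = ({} :: 'a ultrafilter set)" by (simp add: cl_def)
      then have "UNIV \<inter> \<Inter>\<G> = {}" using \<G>(3) by simp
      with fip \<G>(1,2) show False by blast
    qed
    fix A B assume "A \<in> \<Z>" "B \<in> \<Z>"
    then obtain \<G> \<H> where "\<G> \<subseteq> \<F>" "finite \<G>" "\<Inter>\<G> \<subseteq> cl A" "\<H> \<subseteq> \<F>" "finite \<H>" "\<Inter>\<H> \<subseteq> cl B"
      by (auto simp: \<Z>_def)
    then have "A \<inter> B \<in> \<Z>"
      unfolding \<Z>_def by (intro CollectI exI[of _ "\<G> \<union> \<H>"]) (auto simp: cl_def in_uf_Int_iff)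
    then show "\<exists>C\<in>\<Z>. C \<subseteq> A \<inter> B" by blast
  qed
  then obtain q where q: "\<And>A. A \<in> \<Z> \<Longrightarrow> A \<in>\<^sub>u q" by blast
  have "q \<in> X" if "X \<in> \<F>" for X
  proof (rule ccontr)
    assume "q \<notin> X"
    with closed that obtain A where A: "A \<in>\<^sub>u q" "cl A \<subseteq> - X"
      unfolding closed_def open_ultrafilter_def by blast
    then have "\<Inter>{X} \<subseteq> cl (- A)" by (auto simp: cl_def in_uf_Compl_iff)
    then have "- A \<in> \<Z>"
      using that unfolding \<Z>_def by (intro CollectI exI[of _ "{X}"]) simp
    then have "- A \<in>\<^sub>u q" by (rule q)
    with A(1) show False by (simp add: in_uf_Compl_iff)
  qed
  then show "UNIV \<inter> \<Inter>\<F> \<noteq> {}" by blast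
qed

text \<open>By \<open>in_uf_plus_iff\<close> the preimage of a \<open>cl A\<close> is again of this
  form. This is what makes the ultrafilters a right topological semigroup.\<close>

lemma continuous_plus_ultrafilter: "continuous_on UNIV (\<lambda>p :: 'a::plus ultrafilter. p + q)"
  unfolding continuous_on_open_vimage[OF open_UNIV]
proof (intro allI impI)
  fix U :: "'a ultrafilter set"
  assume U: "open U"
  show "open ((\<lambda>p. p + q) -` U \<inter> UNIV)"
    unfolding open_ultrafilter_def
  proof
    fix p assume "p \<in> (\<lambda>p. p + q) -` U \<inter> UNIV"
    with U obtain A where "A \<in>\<^sub>u p + q" "cl A \<subseteq> U"
      unfolding open_ultrafilter_def by auto
    then show "\<exists>A. A \<in>\<^sub>u p \<and> cl A \<subseteq> (\<lambda>p. p + q) -` U \<inter> UNIV"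
      by (intro exI[of _ "{x. {y. x + y \<in> A} \<in>\<^sub>u q}"]) (auto simp: in_uf_plus_iff cl_def subset_iff)
  qed
qed

text \<open>The continuous extension of \<open>f\<close> to ultrafilters. It will carry coordinate
  projections and matrix rows over to ultrafilters of vectors.\<close>

lift_definition map_uf :: "('a \<Rightarrow> 'b) \<Rightarrow> 'a ultrafilter \<Rightarrow> 'b ultrafilter" is filtermap
  by (auto simp: filtermap_bot_iff eventually_filtermap)

lemma in_map_uf_iff: "A \<in>\<^sub>u map_uf f q \<longleftrightarrow> f -` A \<in>\<^sub>u q"
  by (simp add: in_uf_def map_uf.rep_eq eventually_filtermap)

lemma continuous_map_uf: "continuous_on UNIV (map_uf f)"
  unfolding continuous_on_open_vimage[OF open_UNIV]
proof (intro allI impI)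
  fix U :: "'b ultrafilter set"
  assume U: "open U"
  show "open (map_uf f -` U \<inter> UNIV)"
    unfolding open_ultrafilter_def
  proof
    fix p assume "p \<in> map_uf f -` U \<inter> UNIV"
    with U obtain A where "A \<in>\<^sub>u map_uf f p" "cl A \<subseteq> U"
      unfolding open_ultrafilter_def by auto
    then show "\<exists>A. A \<in>\<^sub>u p \<and> cl A \<subseteq> map_uf f -` U \<inter> UNIV"
      by (intro exI[of _ "f -` A"]) (auto simp: in_map_uf_iff cl_def subset_iff)
  qed
qed

lemma map_uf_add:
  assumes "\<And>x y. f (x + y) = f x + f y"
  shows "map_uf f (p + q) = map_uf f p + map_uf f q"
  by (rule ultrafilter_eqI) (simp add: in_map_uf_iff in_uf_plus_iff vimage_def assms)

section \<open>Compact right topological semigroups\<close>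

text \<open>Zorn's lemma for inclusion, stated for a general \<open>Q\<close> in order to serve both
  closed subsemigroups and closed left ideals.\<close>

lemma ex_minimal_closed:
  fixes X\<^sub>0 :: "'a::topological_space set"
  assumes "compact X\<^sub>0" "Q X\<^sub>0"
    and Q: "\<And>X. Q X \<Longrightarrow> closed X \<and> X \<noteq> {}"
    and Inter: "\<And>\<C>. \<C> \<noteq> {} \<Longrightarrow> (\<And>X. X \<in> \<C> \<Longrightarrow> Q X) \<Longrightarrow> \<Inter>\<C> \<noteq> {} \<Longrightarrow> Q (\<Inter>\<C>)"
  shows "\<exists>X. Q X \<and> X \<subseteq> X\<^sub>0 \<and> (\<forall>Y. Q Y \<longrightarrow> Y \<subseteq> X \<longrightarrow> Y = X)"
proof -
  define N where "N = {X. Q X \<and> X \<subseteq> X\<^sub>0}"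
  have "\<exists>m\<in>N. \<forall>a\<in>N. m \<supseteq> a \<longrightarrow> a = m"
  proof (rule predicate_Zorn)
    show "partial_order_on N (relation_of (\<supseteq>) N)"
      by (auto simp: partial_order_on_def preorder_on_def refl_on_def trans_def antisym_def
          relation_of_def)
  next
    fix \<C> assume "\<C> \<in> Chains (relation_of (\<supseteq>) N)"
    then have sub: "\<C> \<subseteq> N" and chain: "\<And>X Y. X \<in> \<C> \<Longrightarrow> Y \<in> \<C> \<Longrightarrow> X \<subseteq> Y \<or> Y \<subseteq> X"
      by (auto simp: Chains_def relation_of_def)
    show "\<exists>u\<in>N. \<forall>a\<in>\<C>. a \<supseteq> u"
    proof (cases "\<C> = {}")
      case True
      then show ?thesis using assms(2) by (auto simp: N_def)
    next
      case False
      \<comment> \<open>A finite part of the chain lies above one of its members, which is nonempty,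
        so compactness applies.\<close>
      have "X\<^sub>0 \<inter> \<Inter>\<C> \<noteq> {}"
      proof (rule compact_imp_fip[OF assms(1)])
        show "closed X" if "X \<in> \<C>" for X using that sub Q by (auto simp: N_def)
        fix \<D> assume "finite \<D>" "\<D> \<subseteq> \<C>"
        have "\<exists>X\<in>\<C>. X \<subseteq> \<Inter>\<D>"
          using \<open>finite \<D>\<close> \<open>\<D> \<subseteq> \<C>\<close>
        proof (induction \<D> rule: finite_induct)
          case empty
          then show ?case using False by blast
        next
          case (insert Y \<D>)
          then obtain X where "X \<in> \<C>" "X \<subseteq> \<Inter>\<D>" "Y \<in> \<C>" by auto
          with chain[of X Y] show ?case by auto
        qed
        then obtain X where X: "X \<in> \<C>" "X \<subseteq> \<Inter>\<D>" by blast
        then have "Q X" "X \<subseteq> X\<^sub>0" using sub by (auto simp: N_def)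
        with Q[of X] have "X \<noteq> {}" "X \<subseteq> X\<^sub>0" by simp_all
        with X show "X\<^sub>0 \<inter> \<Inter>\<D> \<noteq> {}" by blast
      qed
      then have "\<Inter>\<C> \<noteq> {}" by blast
      then have "Q (\<Inter>\<C>)"
        using sub by (intro Inter False) (auto simp: N_def)
      moreover have "\<Inter>\<C> \<subseteq> X\<^sub>0" using False sub by (auto simp: N_def)
      ultimately have "\<Inter>\<C> \<in> N" by (simp add: N_def)
      then show ?thesis by blast
    qed
  qed
  then obtain X where X: "X \<in> N" "\<And>Y. Y \<in> N \<Longrightarrow> Y \<subseteq> X \<Longrightarrow> Y = X" by blast
  have "Y = X" if "Q Y" "Y \<subseteq> X" for Y
    using X that by (intro X(2)) (auto simp: N_def)
  then show ?thesis using X(1) by (auto simp: N_def)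
qed

text \<open>The Ellis-Numakura lemma: every element \<open>e\<close> of a minimal compact
  subsemigroup \<open>Y\<close> is idempotent.\<close>

lemma compact_semigroup_idempotent:
  fixes X :: "'a::{t2_space,semigroup_add} set"
  assumes cont: "\<And>q. continuous_on UNIV (\<lambda>p::'a. p + q)"
    and "compact X" "X \<noteq> {}" "\<And>p q. p \<in> X \<Longrightarrow> q \<in> X \<Longrightarrow> p + q \<in> X"
  shows "\<exists>e\<in>X. e + e = e"
proof -
  define Q where "Q Y \<longleftrightarrow> compact Y \<and> Y \<noteq> {} \<and> (\<forall>p\<in>Y. \<forall>q\<in>Y. p + q \<in> Y)" for Y :: "'a set"
  have "\<exists>Y. Q Y \<and> Y \<subseteq> X \<and> (\<forall>Z. Q Z \<longrightarrow> Z \<subseteq> Y \<longrightarrow> Z = Y)"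
  proof (rule ex_minimal_closed)
    fix \<C> assume C: "\<C> \<noteq> {}" "\<And>Y. Y \<in> \<C> \<Longrightarrow> Q Y" "\<Inter>\<C> \<noteq> {}"
    then obtain Y where "Y \<in> \<C>" by blast
    then have "compact (Y \<inter> \<Inter>\<C>)"
      using C(2) by (intro compact_Int_closed closed_Inter ballI) (auto simp: Q_def compact_imp_closed)
    moreover have "Y \<inter> \<Inter>\<C> = \<Inter>\<C>" using \<open>Y \<in> \<C>\<close> by blast
    ultimately show "Q (\<Inter>\<C>)" using C by (auto simp: Q_def)
  qed (use assms in \<open>auto simp: Q_def compact_imp_closed\<close>)
  then obtain Y where Y: "compact Y" "Y \<noteq> {}" "\<And>p q. p \<in> Y \<Longrightarrow> q \<in> Y \<Longrightarrow> p + q \<in> Y" "Y \<subseteq> X"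
    and min: "\<And>Z. Q Z \<Longrightarrow> Z \<subseteq> Y \<Longrightarrow> Z = Y"
    by (auto simp: Q_def)
  then obtain e where e: "e \<in> Y" by blast
  \<comment> \<open>\<open>Y + e\<close> is a compact subsemigroup of \<open>Y\<close>, hence all of
    \<open>Y\<close>; so \<open>y + e = e\<close> for some \<open>y\<close> in
    \<open>Y\<close>.\<close>
  have "compact ((\<lambda>p. p + e) ` Y)"
    by (intro compact_continuous_image continuous_on_subset[OF cont] Y(1)) simp
  then have "Q ((\<lambda>p. p + e) ` Y)"
    using Y e by (auto simp: Q_def image_iff) (metis add.assoc)
  then have "(\<lambda>p. p + e) ` Y = Y"
    using Y e by (intro min) auto
  then obtain y where y: "y \<in> Y" "y + e = e" using e by (metis (no_types, lifting) imageE)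
  \<comment> \<open>The elements of \<open>Y\<close> with this property of \<open>y\<close> form a
    compact subsemigroup, hence all of \<open>Y\<close>, and \<open>e\<close> is one of
    them.\<close>
  have "closed ((\<lambda>p. p + e) -` {e})"
    by (intro closed_vimage cont closed_singleton)
  then have "compact (Y \<inter> (\<lambda>p. p + e) -` {e})"
    by (intro compact_Int_closed Y(1))
  then have "Q (Y \<inter> (\<lambda>p. p + e) -` {e})"
    using y Y(3) by (auto simp: Q_def add.assoc)
  then have "Y \<inter> (\<lambda>p. p + e) -` {e} = Y"
    by (rule min) simp
  with e Y(4) show ?thesis by auto
qed

text \<open>If \<open>L\<close> is a minimal closed left ideal, then \<open>L + T\<close> is a
  two-sided ideal, so \<open>p = l + t\<close> with \<open>l\<close> in \<open>L\<close>. By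
  minimality \<open>T + (s + l) = L\<close> contains \<open>l\<close>, and adding \<open>t\<close>
  on the right gives the claim.\<close>

lemma smallest_ideal_left_minimal:
  fixes T :: "'a::{t2_space,semigroup_add} set"
  assumes cont: "\<And>q. continuous_on UNIV (\<lambda>p::'a. p + q)"
    and T: "compact T" "subsemigroup T"
    and p: "p \<in> smallest_ideal T" and s: "s \<in> T"
  shows "\<exists>s'\<in>T. s' + (s + p) = p"
proof -
  have TT: "a + b \<in> T" if "a \<in> T" "b \<in> T" for a b
    using T(2) that by (auto simp: subsemigroup_def)
  define Q where "Q L \<longleftrightarrow> closed L \<and> L \<noteq> {} \<and> L \<subseteq> T \<and> (\<forall>t\<in>T. \<forall>l\<in>L. t + l \<in> L)" for L
  have "\<exists>L. Q L \<and> L \<subseteq> T \<and> (\<forall>L'. Q L' \<longrightarrow> L' \<subseteq> L \<longrightarrow> L' = L)"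
  proof (rule ex_minimal_closed)
    fix \<C> assume C: "\<C> \<noteq> {}" "\<And>L. L \<in> \<C> \<Longrightarrow> Q L" "\<Inter>\<C> \<noteq> {}"
    have L: "\<forall>L\<in>\<C>. closed L \<and> L \<subseteq> T \<and> (\<forall>t\<in>T. \<forall>l\<in>L. t + l \<in> L)"
      using C(2) by (simp add: Q_def)
    then have "closed (\<Inter>\<C>)" by (simp add: closed_Inter)
    moreover have "\<Inter>\<C> \<subseteq> T" using C(1) L by blast
    ultimately show "Q (\<Inter>\<C>)" using C(3) L by (simp add: Q_def)
  qed (use T TT in \<open>auto simp: Q_def compact_imp_closed subsemigroup_def\<close>)
  then obtain L where L: "Q L" and min: "\<And>L'. Q L' \<Longrightarrow> L' \<subseteq> L \<Longrightarrow> L' = L"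
    by blast
  have principal: "(\<lambda>t. t + l) ` T = L" if "l \<in> L" for l
  proof (rule min)
    have "compact ((\<lambda>t. t + l) ` T)"
      by (intro compact_continuous_image continuous_on_subset[OF cont] T(1)) simp
    then show "Q ((\<lambda>t. t + l) ` T)"
      using L that T(2) TT by (fastforce simp: Q_def subsemigroup_def image_iff compact_imp_closed
          simp flip: add.assoc)
    show "(\<lambda>t. t + l) ` T \<subseteq> L" using L that by (auto simp: Q_def)
  qed
  have "semigroup_ideal T (L + T)"
    unfolding semigroup_ideal_def
  proof (intro conjI)
    obtain l where "l \<in> L" using L by (auto simp: Q_def)
    with s have "l + s \<in> L + T" by (rule set_plus_intro[rotated])
    then show "L + T \<noteq> {}" by blast
    show "L + T \<subseteq> T" using L TT by (auto simp: Q_def elim!: set_plus_elim)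
    show "T + (L + T) \<subseteq> L + T"
      using L by (force simp: Q_def simp flip: add.assoc elim!: set_plus_elim)
    show "L + T + T \<subseteq> L + T"
      using TT by (auto simp: add.assoc elim!: set_plus_elim)
  qed
  then have "p \<in> L + T"
    using p by (auto simp: smallest_ideal_def)
  then obtain l t where lt: "l \<in> L" "t \<in> T" "p = l + t" by (auto elim: set_plus_elim)
  have "s + l \<in> L" using L lt s by (auto simp: Q_def)
  then obtain s' where "s' \<in> T" "s' + (s + l) = l"
    using principal lt(1) by (metis (no_types, lifting) imageE)
  then show ?thesis using lt(3) by (metis add.assoc)
qed

section \<open>Sums and linear forms\<close>

lemma ssum_apply: "finite F \<Longrightarrow> F \<noteq> {} \<Longrightarrow> ssum x F k = ssum (\<lambda>n. x n k) F"
  by (induction F rule: finite_ne_induct) (simp_all add: ssum_singleton ssum_insert)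

lemma ssum_cong:
  assumes "finite F" "F \<noteq> {}" "\<And>j. j \<in> F \<Longrightarrow> f j = g j"
  shows "ssum f F = ssum g F"
  using assms by (induction F rule: finite_ne_induct) (simp_all add: ssum_singleton ssum_insert)

lemma ssum_add:
  assumes "finite F"
  shows "ssum (\<lambda>j. f j + g j) F = ssum f F + ssum g F"
proof (cases "F = {}")
  \<comment> \<open>Here \<open>ssum\<close> returns the value at the unspecified index
    \<open>Min {}\<close>, which is still additive.\<close>
  case True
  then show ?thesis by (simp add: ssum_def)
next
  case False
  with assms show ?thesis
    by (induction F rule: finite_ne_induct) (simp_all add: ssum_singleton ssum_insert ac_simps)
qed

lemma nmult_add: "nmult c (a + b) = nmult c a + nmult c (b :: 'a::ab_semigroup_add)"
proof -
  have "((+) (a + b) ^^ n) (a + b) = ((+) a ^^ n) a + ((+) b ^^ n) b" for n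
    by (induction n) (simp_all add: ac_simps)
  then show ?thesis by (simp add: nmult_def)
qed

text \<open>\<open>J\<close> plays the role of the support of \<open>c\<close>. A zero coefficient
  has to be kept out of \<open>J\<close>, because \<open>nmult 0 a\<close> is
  \<open>a\<close>.\<close>

definition linear_form :: "('i::linorder \<Rightarrow> nat) \<Rightarrow> 'i set \<Rightarrow> ('i \<Rightarrow> 'a::ab_semigroup_add) \<Rightarrow> 'a" where
  "linear_form c J x = ssum (\<lambda>j. nmult (c j) (x j)) J"

lemma linear_form_add:
  "finite J \<Longrightarrow> linear_form c J (x + y) = linear_form c J x + linear_form c J y"
  by (simp add: linear_form_def nmult_add ssum_add)

lemma linear_form_cong:
  "finite J \<Longrightarrow> J \<noteq> {} \<Longrightarrow> (\<And>j. j \<in> J \<Longrightarrow> x j = y j) \<Longrightarrow> linear_form c J x = linear_form c J y"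
  unfolding linear_form_def by (rule ssum_cong) auto

text \<open>The Galvin-Glazer construction: \<open>x n\<close> is chosen recursively together with a
  set \<open>E n\<close> in \<open>r\<close>, contained in \<open>D n\<close>, such that all finite
  sums with indices from \<open>n\<close> on lie in \<open>E n\<close>.\<close>

lemma idempotent_finite_sums:
  fixes r :: "'a::ab_semigroup_add ultrafilter"
  assumes r: "r + r = r" and D: "\<And>n::nat. D n \<in>\<^sub>u r"
  shows "\<exists>x. \<forall>F. finite F \<longrightarrow> F \<noteq> {} \<longrightarrow> ssum x F \<in> D (Min F)"
proof -
  define P where "P n s \<longleftrightarrow> snd s \<in>\<^sub>u r \<and> snd s \<subseteq> D n \<and> fst s \<in> snd s \<and>
    {y. fst s + y \<in> snd s} \<in>\<^sub>u r" for n and s :: "'a \<times> 'a set"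
  \<comment> \<open>A pair \<open>s\<close> stands for \<open>x n\<close> and \<open>E n\<close>.
    The next set has to lie in \<open>E n\<close> and in its translate by
    \<open>- x n\<close>.\<close>
  define Q where "Q s t \<longleftrightarrow> snd t \<subseteq> snd s \<and> snd t \<subseteq> {y. fst s + y \<in> snd s}"
    for s t :: "'a \<times> 'a set"
  \<comment> \<open>As \<open>E\<close> belongs to \<open>r + r\<close>, the admissible
    \<open>x\<close> form a set in \<open>r\<close>, which therefore meets \<open>E\<close>.\<close>
  have ex: "\<exists>x. x \<in> E \<and> {y. x + y \<in> E} \<in>\<^sub>u r" if "E \<in>\<^sub>u r" for E
  proof -
    have "{x. {y. x + y \<in> E} \<in>\<^sub>u r} \<in>\<^sub>u r"
      using that r in_uf_plus_iff[of E r r] by simp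
    with that have "E \<inter> {x. {y. x + y \<in> E} \<in>\<^sub>u r} \<in>\<^sub>u r"
      by (simp add: in_uf_Int_iff)
    from in_uf_nonempty[OF this] show ?thesis by auto
  qed
  have "\<exists>s. \<forall>n. P n (s n) \<and> Q (s n) (s (Suc n))"
  proof (rule dependent_nat_choice)
    obtain x where "x \<in> D 0" "{y. x + y \<in> D 0} \<in>\<^sub>u r" using ex[OF D] by blast
    then have "P 0 (x, D 0)" using D by (simp add: P_def)
    then show "\<exists>s. P 0 s" ..
  next
    fix s n assume "P n s"
    define E where "E = D (Suc n) \<inter> (snd s \<inter> {y. fst s + y \<in> snd s})"
    have "E \<in>\<^sub>u r" using \<open>P n s\<close> D by (simp add: E_def P_def in_uf_Int_iff)
    then obtain x where "x \<in> E" "{y. x + y \<in> E} \<in>\<^sub>u r" using ex by blast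
    then have "P (Suc n) (x, E)" "Q s (x, E)"
      using \<open>E \<in>\<^sub>u r\<close> by (auto simp: P_def Q_def E_def)
    then show "\<exists>t. P (Suc n) t \<and> Q s t" by blast
  qed
  then obtain s where s: "\<And>n. P n (s n)" "\<And>n. Q (s n) (s (Suc n))" by blast
  define x where "x n = fst (s n)" for n
  define E where "E n = snd (s n)" for n
  have xE: "x n \<in> E n" and ED: "E n \<subseteq> D n" for n
    using s(1)[of n] by (auto simp: P_def x_def E_def)
  have step: "E (Suc n) \<subseteq> E n" "y \<in> E (Suc n) \<Longrightarrow> x n + y \<in> E n" for n y
    using s(2)[of n] by (auto simp: Q_def x_def E_def)
  have mono: "E n \<subseteq> E m" if "m \<le> n" for m n
    using step(1) that by (rule lift_Suc_antimono_le)
  \<comment> \<open>The induction adds a new minimum \<open>m\<close>: the sum of the later terms is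
    in \<open>E (Suc m)\<close>, so adding \<open>x m\<close> to it leads into
    \<open>E m\<close>.\<close>
  have "F \<noteq> {} \<Longrightarrow> ssum x F \<in> E (Min F)" if "finite F" for F
    using that
  proof (induction F rule: finite_linorder_min_induct)
    case (insert m F)
    show ?case
    proof (cases "F = {}")
      case True
      then show ?thesis using xE by (simp add: ssum_singleton)
    next
      case False
      then have "Suc m \<le> Min F" using insert by (simp add: Suc_le_eq)
      then have "ssum x F \<in> E (Suc m)" using mono insert False by blast
      moreover have "Min (insert m F) = m"
        using insert by (intro Min_eqI) (auto intro: less_imp_le)
      moreover have "m \<notin> F" using insert by blast
      ultimately show ?thesis
        using step(2) insert False by (simp add: ssum_insert)
    qed
  qed simp
  with ED show ?thesis by blast
qed

section \<open>The semigroup determined by a family of sets\<close>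

text \<open>\<open>\<A>\<close> behaves like a base of open neighbourhoods of a zero that may be
  absent: \<open>translate\<close> expresses openness, \<open>halve\<close> continuity of addition
  at zero. The ultrafilters in \<open>core\<close> are those converging to it.\<close>

locale neighbourhood_base =
  fixes \<A> :: "'a::ab_semigroup_add set set"
  assumes nonempty: "\<A> \<noteq> {}" and empty: "{} \<notin> \<A>"
    and Int: "A \<in> \<A> \<Longrightarrow> B \<in> \<A> \<Longrightarrow> A \<inter> B \<in> \<A>"
    and translate: "A \<in> \<A> \<Longrightarrow> a \<in> A \<Longrightarrow> \<exists>B\<in>\<A>. a +o B \<subseteq> A"
    and halve: "A \<in> \<A> \<Longrightarrow> \<exists>B\<in>\<A>. B + B \<subseteq> A"
begin

definition core :: "'a ultrafilter set" where
  "core = (\<Inter>A\<in>\<A>. cl A)"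

lemma core_iff: "q \<in> core \<longleftrightarrow> (\<forall>A\<in>\<A>. A \<in>\<^sub>u q)"
  by (simp add: core_def cl_def)

lemma translateE:
  assumes "A \<in> \<A>" "a \<in> A"
  obtains B where "B \<in> \<A>" "\<And>b. b \<in> B \<Longrightarrow> a + b \<in> A"
  using translate[OF assms] by (auto simp: elt_set_plus_def)

lemma halveE:
  assumes "A \<in> \<A>"
  obtains B where "B \<in> \<A>" "\<And>a b. a \<in> B \<Longrightarrow> b \<in> B \<Longrightarrow> a + b \<in> A"
  using halve[OF assms] by (auto simp: set_plus_def)

lemma compact_core: "compact core"
  using compact_Int_closed[OF compact_UNIV_ultrafilter, of core]
  by (simp add: core_def closed_INT closed_cl)

text \<open>By \<open>translate\<close>, each \<open>a\<close> in \<open>A\<close> has a member of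
  \<open>\<A>\<close>, hence of \<open>q\<close>, that it moves into \<open>A\<close>; and
  \<open>A\<close> itself is in \<open>p\<close>.\<close>

lemma core_add:
  assumes "p \<in> core" "q \<in> core"
  shows "p + q \<in> core"
  unfolding core_iff in_uf_plus_iff
proof
  fix A assume A: "A \<in> \<A>"
  have "{b. a + b \<in> A} \<in>\<^sub>u q" if "a \<in> A" for a
  proof -
    obtain B where "B \<in> \<A>" "\<And>b. b \<in> B \<Longrightarrow> a + b \<in> A" using translateE A \<open>a \<in> A\<close> by metis
    with assms(2) show ?thesis by (auto simp: core_iff intro: in_uf_mono)
  qed
  moreover have "A \<in>\<^sub>u p" using assms(1) A by (simp add: core_iff)
  ultimately show "{a. {b. a + b \<in> A} \<in>\<^sub>u q} \<in>\<^sub>u p" by (auto intro: in_uf_mono)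
qed

lemma subsemigroup_core: "subsemigroup core"
proof -
  have "\<exists>q. \<forall>A\<in>\<A>. A \<in>\<^sub>u q"
    using nonempty empty Int by (intro ex_ultrafilter) blast+
  then have "core \<noteq> {}" using core_iff by blast
  then show ?thesis by (auto simp: subsemigroup_def core_add elim!: set_plus_elim)
qed

lemma smallest_ideal_core: "smallest_ideal core \<subseteq> core"
proof -
  have "semigroup_ideal core core"
    using subsemigroup_core by (simp add: semigroup_ideal_def subsemigroup_def)
  then show ?thesis by (auto simp: smallest_ideal_def)
qed

section \<open>Small arguments give small values of linear forms\<close>

lemma nmult_small:
  assumes "c > 0" "A \<in> \<A>"
  shows "\<exists>B\<in>\<A>. \<forall>b\<in>B. nmult c b \<in> A"
  using assms
proof (induction c arbitrary: A rule: nat_induct_non_zero)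
  case 1
  then show ?case using nmult_1 by metis
next
  case (Suc c)
  obtain B where B: "B \<in> \<A>" "\<And>a b. a \<in> B \<Longrightarrow> b \<in> B \<Longrightarrow> a + b \<in> A" using halveE Suc.prems by metis
  obtain B' where B': "B' \<in> \<A>" "\<forall>b\<in>B'. nmult c b \<in> B" using Suc.IH[OF B(1)] by blast
  have "\<forall>b\<in>B \<inter> B'. nmult (Suc c) b \<in> A"
    using B B' Suc.hyps by (simp add: nmult_Suc)
  then show ?case using Int B(1) B'(1) by blast
qed

lemma linear_form_small:
  assumes "finite J" "J \<noteq> {}" "\<And>j. j \<in> J \<Longrightarrow> c j > 0" "A \<in> \<A>"
  shows "\<exists>B\<in>\<A>. \<forall>x. (\<forall>j\<in>J. x j \<in> B) \<longrightarrow> linear_form c J x \<in> A"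
  using assms
proof (induction J arbitrary: A rule: finite_ne_induct)
  case (singleton j)
  then show ?case using nmult_small[of "c j" A] by (auto simp: linear_form_def ssum_singleton)
next
  case (insert j J)
  obtain B where B: "B \<in> \<A>" "\<And>a b. a \<in> B \<Longrightarrow> b \<in> B \<Longrightarrow> a + b \<in> A" using halveE insert.prems by metis
  obtain B' where B': "B' \<in> \<A>" "\<forall>b\<in>B'. nmult (c j) b \<in> B"
    using nmult_small[of "c j" B] insert.prems B(1) by auto
  obtain B'' where B'': "B'' \<in> \<A>" "\<forall>x. (\<forall>j\<in>J. x j \<in> B'') \<longrightarrow> linear_form c J x \<in> B"
    using insert.IH[of B] insert.prems B(1) by auto
  have "\<forall>x. (\<forall>j\<in>insert j J. x j \<in> B' \<inter> B'') \<longrightarrow> linear_form c (insert j J) x \<in> A"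
    using B B' B'' insert.hyps by (simp add: linear_form_def ssum_insert)
  then show ?case using Int B'(1) B''(1) by blast
qed

text \<open>Since \<open>J\<close> is finite, all coordinates in \<open>J\<close> are small
  simultaneously on a set in \<open>r\<close>. This yields the hypothesis on \<open>f i\<close> in
  \<open>central_sets\<close>.\<close>

lemma map_linear_form_in_core:
  assumes "finite J" "J \<noteq> {}" "\<And>j. j \<in> J \<Longrightarrow> c j > 0"
    and r: "\<And>j. j \<in> J \<Longrightarrow> map_uf (\<lambda>x. x j) r \<in> core"
  shows "map_uf (linear_form c J) r \<in> core"
  unfolding core_iff in_map_uf_iff
proof
  fix A assume "A \<in> \<A>"
  then obtain B where B: "B \<in> \<A>" "\<And>x. (\<forall>j\<in>J. x j \<in> B) \<Longrightarrow> linear_form c J x \<in> A"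
    using linear_form_small[of J c A] assms(1-3) by auto
  have "(\<Inter>j\<in>J. (\<lambda>x. x j) -` B) \<in>\<^sub>u r"
    using r B(1) by (intro in_uf_INT assms(1)) (simp add: core_iff in_map_uf_iff)
  then show "linear_form c J -` A \<in>\<^sub>u r"
    by (rule in_uf_mono) (use B(2) in auto)
qed

text \<open>A vector \<open>(a, a + f\<^sub>i w)\<^sub>i\<close> is encoded as a function on \<open>'i option\<close>, the value \<open>None\<close>
  indexing the first coordinate. The ultrafilters concentrated on such vectors, with \<open>a\<close> tending
  to \<^const>\<open>core\<close> and \<open>w\<close> to \<open>r\<close>, form a closed semigroup \<open>I\<close> that absorbs the diagonal copy
  \<open>P\<close> of \<open>p\<close>. An idempotent \<open>e \<in> I + P\<close> has its marginals in the minimal left ideal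
  \<open>core + p\<close>, for which they are right identities. Hence all marginals of
  \<open>P + e \<in> I\<close> are equal to \<open>p\<close>.\<close>

lemma central_sets:
  fixes f :: "'i \<Rightarrow> 'b::semigroup_add \<Rightarrow> 'a"
  assumes f_add: "\<And>i x y. f i (x + y) = f i x + f i y"
    and r: "r + r = r"
    and J: "finite J" "\<And>i. i \<in> J \<Longrightarrow> map_uf (f i) r \<in> core"
    and p: "p + p = p" "p \<in> smallest_ideal core"
    and C: "C \<in>\<^sub>u p" and R: "R \<in>\<^sub>u r"
  shows "\<exists>a\<in>C. \<exists>w\<in>R. \<forall>i\<in>J. a + f i w \<in> C"
proof -
  define g where "g a w k = (case k of None \<Rightarrow> a | Some i \<Rightarrow> a + f i w)" for a w k
  define \<Delta> :: "'a \<Rightarrow> 'i option \<Rightarrow> 'a" where "\<Delta> b = (\<lambda>_. b)" for b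
  have g_add: "g a w + g a' w' = g (a + a') (w + w')" for a w a' w'
    by (auto simp: g_def fun_eq_iff f_add ac_simps split: option.split)
  have \<Delta>_g: "\<Delta> b + g a w = g (b + a) w" for a b w
    by (auto simp: g_def \<Delta>_def fun_eq_iff ac_simps split: option.split)
  have g_\<Delta>: "g a w + \<Delta> b = g (a + b) w" for a b w
    by (auto simp: g_def \<Delta>_def fun_eq_iff ac_simps split: option.split)
  define X where "X B R = {g a w |a w. a \<in> B \<and> w \<in> R}" for B R
  have XI: "g a w \<in> X B R" if "a \<in> B" "w \<in> R" for a w B R
    using that unfolding X_def by blast
  have XE: "\<exists>a w. x = g a w \<and> a \<in> B \<and> w \<in> R" if "x \<in> X B R" for x B R
    using that unfolding X_def by blast
  define I where "I = {s. \<forall>B\<in>\<A>. \<forall>R. R \<in>\<^sub>u r \<longrightarrow> X B R \<in>\<^sub>u s}"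
  define P where "P = map_uf \<Delta> p"
  have I_D: "X B R \<in>\<^sub>u s" if "s \<in> I" "B \<in> \<A>" "R \<in>\<^sub>u r" for s B R
    using that by (simp add: I_def)
  have p_core: "p \<in> core" using p smallest_ideal_core by blast

  have "closed I"
  proof -
    have "I = (\<Inter>B\<in>\<A>. \<Inter>R\<in>{R. R \<in>\<^sub>u r}. cl (X B R))" by (auto simp: I_def cl_def)
    then show ?thesis by (simp add: closed_INT closed_cl)
  qed
  then have "compact I" using compact_Int_closed[OF compact_UNIV_ultrafilter] by fastforce
  have "I \<noteq> {}"
  proof -
    have "\<exists>s. \<forall>Y\<in>{X B R |B R. B \<in> \<A> \<and> R \<in>\<^sub>u r}. Y \<in>\<^sub>u s"
    proof (rule ex_ultrafilter)
      show "{X B R |B R. B \<in> \<A> \<and> R \<in>\<^sub>u r} \<noteq> {}" using nonempty R by blast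
      have "X B R \<noteq> {}" if "B \<in> \<A>" "R \<in>\<^sub>u r" for B R
      proof -
        have "B \<noteq> {}" using that empty by blast
        moreover have "\<exists>w. w \<in> R" using that(2) by (rule in_uf_nonempty)
        ultimately show ?thesis by (auto simp: X_def)
      qed
      then show "{} \<notin> {X B R |B R. B \<in> \<A> \<and> R \<in>\<^sub>u r}" by blast
      fix Y Z assume "Y \<in> {X B R |B R. B \<in> \<A> \<and> R \<in>\<^sub>u r}" "Z \<in> {X B R |B R. B \<in> \<A> \<and> R \<in>\<^sub>u r}"
      then obtain B R B' R' where *: "Y = X B R" "Z = X B' R'" "B \<in> \<A>" "B' \<in> \<A>" "R \<in>\<^sub>u r" "R' \<in>\<^sub>u r"
        by blast
      then have "X (B \<inter> B') (R \<inter> R') \<subseteq> Y \<inter> Z" by (auto simp: X_def)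
      moreover have "B \<inter> B' \<in> \<A>" "R \<inter> R' \<in>\<^sub>u r" using * Int by (auto simp: in_uf_Int_iff)
      ultimately show "\<exists>W\<in>{X B R |B R. B \<in> \<A> \<and> R \<in>\<^sub>u r}. W \<subseteq> Y \<inter> Z" by blast
    qed
    then show ?thesis by (auto simp: I_def)
  qed

  have I_I: "s + t \<in> I" if s: "s \<in> I" and t: "t \<in> I" for s t
    unfolding I_def mem_Collect_eq in_uf_plus_iff
  proof (intro ballI allI impI)
    fix B R assume B: "B \<in> \<A>" and R: "R \<in>\<^sub>u r"
    \<comment> \<open>By \<open>r + r = r\<close>, almost every \<open>w\<close> leaves enough
      \<open>w'\<close> with \<open>w + w'\<close> in \<open>R\<close>. The admissible second
      summand depends on \<open>a\<close> and \<open>w\<close>, as the order of the quantifiers in a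
      sum of ultrafilters permits.\<close>
    define R' where "R' = {w. {w'. w + w' \<in> R} \<in>\<^sub>u r}"
    have "R' \<in>\<^sub>u r" using R r in_uf_plus_iff[of R r r] by (simp add: R'_def)
    then have "X B R' \<in>\<^sub>u s" using I_D s B by blast
    moreover have "{y. x + y \<in> X B R} \<in>\<^sub>u t" if xX: "x \<in> X B R'" for x
    proof -
      obtain a w where x: "x = g a w" "a \<in> B" "w \<in> R'" using XE[OF xX] by blast
      then obtain B' where B': "B' \<in> \<A>" "\<And>b. b \<in> B' \<Longrightarrow> a + b \<in> B" using translateE B by metis
      have "X B' {w'. w + w' \<in> R} \<in>\<^sub>u t"
        using x(3) by (intro I_D t B'(1)) (simp add: R'_def)
      moreover have "X B' {w'. w + w' \<in> R} \<subseteq> {y. x + y \<in> X B R}"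
        using B'(2) by (auto simp: x(1) g_add intro!: XI dest!: XE)
      ultimately show ?thesis by (rule in_uf_mono)
    qed
    ultimately show "{x. {y. x + y \<in> X B R} \<in>\<^sub>u t} \<in>\<^sub>u s" by (auto intro: in_uf_mono)
  qed
  \<comment> \<open>A diagonal vector moves only the \<open>a\<close> of \<open>g a w\<close> and
    leaves \<open>w\<close> alone, so it is enough that \<open>p\<close> lies in
    \<open>core\<close>.\<close>
  have P_I: "P + t \<in> I" if t: "t \<in> I" for t
    unfolding I_def mem_Collect_eq in_uf_plus_iff
  proof (intro ballI allI impI)
    fix B R assume B: "B \<in> \<A>" and R: "R \<in>\<^sub>u r"
    have "{y. \<Delta> b + y \<in> X B R} \<in>\<^sub>u t" if b: "b \<in> B" for b
    proof -
      obtain B' where B': "B' \<in> \<A>" "\<And>a. a \<in> B' \<Longrightarrow> b + a \<in> B" using translateE B b by metis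
      have "X B' R \<in>\<^sub>u t" by (intro I_D t B'(1) R)
      moreover have "X B' R \<subseteq> {y. \<Delta> b + y \<in> X B R}"
        using B'(2) by (auto simp: \<Delta>_g intro!: XI dest!: XE)
      ultimately show ?thesis by (rule in_uf_mono)
    qed
    moreover have "B \<in>\<^sub>u p" using p_core B by (simp add: core_iff)
    ultimately show "{x. {y. x + y \<in> X B R} \<in>\<^sub>u t} \<in>\<^sub>u P"
      by (auto simp: P_def in_map_uf_iff intro: in_uf_mono)
  qed
  have I_P: "s + P \<in> I" if s: "s \<in> I" for s
    unfolding I_def mem_Collect_eq in_uf_plus_iff
  proof (intro ballI allI impI)
    fix B R assume B: "B \<in> \<A>" and R: "R \<in>\<^sub>u r"
    have "{y. x + y \<in> X B R} \<in>\<^sub>u P" if xX: "x \<in> X B R" for x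
    proof -
      obtain a w where x: "x = g a w" "a \<in> B" "w \<in> R" using XE[OF xX] by blast
      then obtain B' where B': "B' \<in> \<A>" "\<And>b. b \<in> B' \<Longrightarrow> a + b \<in> B" using translateE B by metis
      have "B' \<in>\<^sub>u p" using p_core B'(1) by (simp add: core_iff)
      moreover have "B' \<subseteq> \<Delta> -` {y. x + y \<in> X B R}"
        using B'(2) x(3) by (auto simp: x(1) g_\<Delta> intro!: XI)
      ultimately show ?thesis unfolding P_def in_map_uf_iff by (rule in_uf_mono)
    qed
    with I_D[OF s B R] show "{x. {y. x + y \<in> X B R} \<in>\<^sub>u P} \<in>\<^sub>u s" by (auto intro: in_uf_mono)
  qed

  \<comment> \<open>\<open>I + P\<close> is closed under addition because
    \<open>(s + P) + (t + P) = (s + (P + t)) + P\<close>.\<close>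
  have "\<exists>e\<in>(\<lambda>s. s + P) ` I. e + e = e"
  proof (rule compact_semigroup_idempotent[OF continuous_plus_ultrafilter])
    show "compact ((\<lambda>s. s + P) ` I)"
      by (intro compact_continuous_image \<open>compact I\<close>
          continuous_on_subset[OF continuous_plus_ultrafilter]) simp
    show "(\<lambda>s. s + P) ` I \<noteq> {}" using \<open>I \<noteq> {}\<close> by simp
    fix x y assume "x \<in> (\<lambda>s. s + P) ` I" "y \<in> (\<lambda>s. s + P) ` I"
    then obtain s t where "s \<in> I" "t \<in> I" "x = s + P" "y = t + P" by blast
    then have "x + y = (s + (P + t)) + P" "s + (P + t) \<in> I"
      using P_I I_I by (simp_all add: add.assoc)
    then show "x + y \<in> (\<lambda>s. s + P) ` I" by blast
  qed
  then obtain t where t: "t \<in> I" "(t + P) + (t + P) = t + P" by blast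
  define marg :: "'i option \<Rightarrow> _ \<Rightarrow> 'a ultrafilter" where "marg k = map_uf (\<lambda>x. x k)" for k
  have marg_add: "marg k (x + y) = marg k x + marg k y" for k x y
    unfolding marg_def by (rule map_uf_add) simp
  have marg_P: "marg k P = p" for k
    by (rule ultrafilter_eqI[symmetric]) (simp add: marg_def P_def in_map_uf_iff \<Delta>_def vimage_def)
  have marg_t: "marg k t \<in> core" if k: "k \<in> insert None (Some ` J)" for k
    unfolding core_iff
  proof
    fix A assume A: "A \<in> \<A>"
    \<comment> \<open>At \<open>Some i\<close> the value is \<open>a + f i w\<close>; halving
      \<open>A\<close> leaves room for both summands.\<close>
    have "\<exists>B\<in>\<A>. \<exists>R. R \<in>\<^sub>u r \<and> (\<forall>a\<in>B. \<forall>w\<in>R. g a w k \<in> A)"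
    proof (cases k)
      case None
      then show ?thesis using A by (intro bexI[of _ A] exI[of _ UNIV]) (simp_all add: g_def)
    next
      case (Some i)
      obtain B where B: "B \<in> \<A>" "\<And>a b. a \<in> B \<Longrightarrow> b \<in> B \<Longrightarrow> a + b \<in> A" using halveE A by metis
      then have "f i -` B \<in>\<^sub>u r" using J(2) Some k by (auto simp: core_iff in_map_uf_iff)
      with B Some show ?thesis by (intro bexI[of _ B] exI[of _ "f i -` B"]) (auto simp: g_def)
    qed
    then obtain B R where B: "B \<in> \<A>" "R \<in>\<^sub>u r" "\<And>a w. a \<in> B \<Longrightarrow> w \<in> R \<Longrightarrow> g a w k \<in> A" by blast
    then have "X B R \<subseteq> (\<lambda>x. x k) -` A" by (auto simp: X_def)
    then show "A \<in>\<^sub>u marg k t"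
      unfolding marg_def in_map_uf_iff by (rule in_uf_mono[OF I_D[OF t(1) B(1,2)]])
  qed
  \<comment> \<open>The marginal \<open>e\<close> is an idempotent of the form
    \<open>marg k t + p\<close>. Left minimality gives \<open>s' + e = p\<close>, whence
    \<open>p + e = s' + e + e = p\<close>.\<close>
  have marg_p: "marg k (P + (t + P)) = p" if k: "k \<in> insert None (Some ` J)" for k
  proof -
    define e where "e = marg k (t + P)"
    have "e + e = e" using arg_cong[OF t(2), of "marg k"] by (simp add: e_def marg_add)
    have "e = marg k t + p" by (simp add: e_def marg_add marg_P)
    then obtain s' where "s' + e = p"
      using smallest_ideal_left_minimal[OF continuous_plus_ultrafilter compact_core
          subsemigroup_core p(2) marg_t[OF k]] by auto
    then have "p + e = p" using \<open>e + e = e\<close> by (metis add.assoc)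
    then show ?thesis by (simp add: marg_add[of k P] marg_P e_def)
  qed
  \<comment> \<open>Any \<open>B\<close> will do: it is only the \<open>w\<close> in
    \<open>R\<close> that is wanted from \<open>X B R\<close>.\<close>
  obtain B where "B \<in> \<A>" using nonempty by blast
  then have "X B R \<in>\<^sub>u P + (t + P)" using I_D P_I I_P t(1) R by blast
  moreover have "(\<Inter>k\<in>insert None (Some ` J). (\<lambda>x. x k) -` C) \<in>\<^sub>u P + (t + P)"
  proof (intro in_uf_INT)
    show "(\<lambda>x. x k) -` C \<in>\<^sub>u P + (t + P)" if "k \<in> insert None (Some ` J)" for k
      using marg_p[OF that] C by (simp add: marg_def flip: in_map_uf_iff)
  qed (use J in simp)
  ultimately have "X B R \<inter> (\<Inter>k\<in>insert None (Some ` J). (\<lambda>x. x k) -` C) \<in>\<^sub>u P + (t + P)"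
    by (simp add: in_uf_Int_iff)
  from in_uf_nonempty[OF this] obtain x
    where x: "x \<in> X B R" "\<And>k. k \<in> insert None (Some ` J) \<Longrightarrow> x k \<in> C" by auto
  obtain a w where xw: "x = g a w" "w \<in> R" using XE[OF x(1)] by blast
  have "a \<in> C" "\<forall>i\<in>J. a + f i w \<in> C"
    using x(2)[of None] x(2)[of "Some i" for i] by (auto simp: xw(1) g_def)
  with xw(2) show ?thesis by blast
qed

text \<open>The passage from single solutions to an idempotent. The solution sets
  \<open>S A C\<close> form a filter base, and the ultrafilters with the required images form a
  compact semigroup \<open>Y\<close>, since \<open>core\<close> is a semigroup, \<open>p\<close> is
  idempotent and the \<open>\<phi> i\<close> are additive.\<close>

lemma ex_idempotent_solution:
  fixes \<phi> :: "'i \<Rightarrow> ('j \<Rightarrow> 'a) \<Rightarrow> 'a"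
  assumes \<phi>_add: "\<And>i x y. i \<in> H \<Longrightarrow> \<phi> i (x + y) = \<phi> i x + \<phi> i y"
    and p: "p + p = p"
    and sol: "\<And>A C. A \<in> \<A> \<Longrightarrow> C \<in>\<^sub>u p \<Longrightarrow> \<exists>x. (\<forall>j\<in>N. x j \<in> A) \<and> (\<forall>i\<in>H. \<phi> i x \<in> C)"
  shows "\<exists>r. r + r = r \<and> (\<forall>j\<in>N. map_uf (\<lambda>x. x j) r \<in> core) \<and> (\<forall>i\<in>H. map_uf (\<phi> i) r = p)"
proof -
  define S where "S A C = {x. (\<forall>j\<in>N. x j \<in> A) \<and> (\<forall>i\<in>H. \<phi> i x \<in> C)}" for A C
  define Y where "Y = (\<Inter>j\<in>N. map_uf (\<lambda>x. x j) -` core) \<inter> (\<Inter>i\<in>H. map_uf (\<phi> i) -` {p})"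
  have "\<exists>q. \<forall>Z\<in>{S A C |A C. A \<in> \<A> \<and> C \<in>\<^sub>u p}. Z \<in>\<^sub>u q"
  proof (rule ex_ultrafilter)
    show "{S A C |A C. A \<in> \<A> \<and> C \<in>\<^sub>u p} \<noteq> {}" using nonempty in_uf_UNIV by blast
    have "S A C \<noteq> {}" if "A \<in> \<A>" "C \<in>\<^sub>u p" for A C
      using sol[OF that] by (auto simp: S_def)
    then show "{} \<notin> {S A C |A C. A \<in> \<A> \<and> C \<in>\<^sub>u p}" by blast
    fix Z W assume "Z \<in> {S A C |A C. A \<in> \<A> \<and> C \<in>\<^sub>u p}" "W \<in> {S A C |A C. A \<in> \<A> \<and> C \<in>\<^sub>u p}"
    then obtain A C A' C' where *: "Z = S A C" "W = S A' C'" "A \<in> \<A>" "A' \<in> \<A>" "C \<in>\<^sub>u p" "C' \<in>\<^sub>u p"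
      by blast
    then have "S (A \<inter> A') (C \<inter> C') \<subseteq> Z \<inter> W" by (auto simp: S_def)
    moreover have "A \<inter> A' \<in> \<A>" "C \<inter> C' \<in>\<^sub>u p" using * Int by (auto simp: in_uf_Int_iff)
    ultimately show "\<exists>V\<in>{S A C |A C. A \<in> \<A> \<and> C \<in>\<^sub>u p}. V \<subseteq> Z \<inter> W" by blast
  qed
  then obtain q where q: "\<And>A C. A \<in> \<A> \<Longrightarrow> C \<in>\<^sub>u p \<Longrightarrow> S A C \<in>\<^sub>u q" by blast
  have "map_uf (\<lambda>x. x j) q \<in> core" if "j \<in> N" for j
    unfolding core_iff in_map_uf_iff
  proof
    fix A assume "A \<in> \<A>"
    from q[OF this in_uf_UNIV] show "(\<lambda>x. x j) -` A \<in>\<^sub>u q"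
      by (rule in_uf_mono) (use that in \<open>auto simp: S_def\<close>)
  qed
  moreover have "map_uf (\<phi> i) q = p" if "i \<in> H" for i
  proof (rule ultrafilter_eqI[symmetric])
    fix C assume "C \<in>\<^sub>u p"
    moreover obtain A where "A \<in> \<A>" using nonempty by blast
    ultimately have "S A C \<in>\<^sub>u q" by (intro q)
    then show "C \<in>\<^sub>u map_uf (\<phi> i) q"
      unfolding in_map_uf_iff by (rule in_uf_mono) (use that in \<open>auto simp: S_def\<close>)
  qed
  \<comment> \<open>\<open>q\<close> need not be idempotent; it shows that \<open>Y\<close> is
    nonempty.\<close>
  ultimately have "q \<in> Y" by (simp add: Y_def)
  have "closed Y"
    unfolding Y_def using compact_imp_closed[OF compact_core]
    by (intro closed_Int closed_INT ballI closed_vimage continuous_map_uf) auto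
  then have "compact Y" using compact_Int_closed[OF compact_UNIV_ultrafilter] by fastforce
  have "\<exists>r\<in>Y. r + r = r"
  proof (rule compact_semigroup_idempotent[OF continuous_plus_ultrafilter \<open>compact Y\<close>])
    show "Y \<noteq> {}" using \<open>q \<in> Y\<close> by blast
    fix r s assume "r \<in> Y" "s \<in> Y"
    have "map_uf (\<lambda>x. x j) (r + s) = map_uf (\<lambda>x. x j) r + map_uf (\<lambda>x. x j) s" for j
      by (rule map_uf_add) simp
    moreover have "map_uf (\<phi> i) (r + s) = map_uf (\<phi> i) r + map_uf (\<phi> i) s" if "i \<in> H" for i
      using that by (intro map_uf_add \<phi>_add)
    ultimately show "r + s \<in> Y"
      using \<open>r \<in> Y\<close> \<open>s \<in> Y\<close> p by (simp add: Y_def core_add)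
  qed
  then show ?thesis by (auto simp: Y_def)
qed

end

section \<open>Matrices satisfying the first entries condition\<close>

definition support :: "nat mat \<Rightarrow> nat \<Rightarrow> nat set" where
  "support M i = {j. j < dim_col M \<and> M $$ (i, j) \<noteq> 0}"

text \<open>The argument is a function on all of \<open>nat\<close>, so that pointwise addition
  turns the vectors into a semigroup whose ultrafilters can be added.\<close>

definition row_form :: "nat mat \<Rightarrow> nat \<Rightarrow> (nat \<Rightarrow> 'a::ab_semigroup_add) \<Rightarrow> 'a" where
  "row_form M i = linear_form (\<lambda>j. M $$ (i, j)) (support M i)"

lemma finite_support [simp]: "finite (support M i)"
  by (simp add: support_def)

lemma first_col_in_support:
  assumes "first_entries_condition M" "i < dim_row M"
  shows "first_col M i \<in> support M i"
proof -
  have "\<exists>j. j < dim_col M \<and> M $$ (i, j) \<noteq> 0"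
    using assms by (auto simp: first_entries_condition_def)
  from LeastI_ex[OF this] show ?thesis by (simp add: first_col_def support_def)
qed

lemma first_col_le: "j \<in> support M i \<Longrightarrow> first_col M i \<le> j"
  by (simp add: support_def first_col_def Least_le)

text \<open>Induction on the column \<open>k\<close>, downwards from \<open>v\<close> to
  \<open>0\<close>. At stage \<open>k\<close> the idempotent handles the rows in \<open>H k\<close>,
  those whose first nonzero entry is in column \<open>k\<close> or later.\<close>

lemma (in neighbourhood_base) ex_idempotent_matrix:
  assumes M: "M \<in> carrier_mat u v" "first_entries_condition M"
    and p: "p + p = p" "p \<in> smallest_ideal core"
    and pM: "\<And>A c. A \<in> \<A> \<Longrightarrow> c \<in> first_entries M \<Longrightarrow> nmult c ` A \<in>\<^sub>u p"
  shows "\<exists>r. r + r = r \<and> (\<forall>j<v. map_uf (\<lambda>x. x j) r \<in> core) \<and> (\<forall>i<u. map_uf (row_form M i) r = p)"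
proof -
  have dim [simp]: "dim_row M = u" "dim_col M = v" using M by auto
  define H where "H k = {i. i < u \<and> first_col M i \<ge> k}" for k
  have "finite (H k)" for k by (simp add: H_def)
  have "\<exists>r. r + r = r \<and> (\<forall>j\<in>{..<v}. map_uf (\<lambda>x. x j) r \<in> core) \<and>
      (\<forall>i\<in>H 0. map_uf (row_form M i) r = p)"
  proof (rule inc_induct[of 0 v])
    \<comment> \<open>No row starts at \<open>v\<close>, so only the coordinates matter, and the
      diagonal copy of \<open>p\<close> is a suitable start.\<close>
    have "H v = {}"
      using first_col_in_support[OF M(2)] by (fastforce simp: H_def support_def)
    moreover have "map_uf (\<lambda>b _. b) p + map_uf (\<lambda>b _. b) p = map_uf (\<lambda>b (_ :: nat). b) p"
      by (subst map_uf_add[symmetric]) (auto simp: p)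
    moreover have "map_uf (\<lambda>x. x j) (map_uf (\<lambda>b (_ :: nat). b) p) \<in> core" for j
      using p(2) smallest_ideal_core by (auto simp: core_iff in_map_uf_iff vimage_def)
    ultimately show "\<exists>r. r + r = r \<and> (\<forall>j\<in>{..<v}. map_uf (\<lambda>x. x j) r \<in> core) \<and>
        (\<forall>i\<in>H v. map_uf (row_form M i) r = p)"
      by (intro exI[of _ "map_uf (\<lambda>b _. b) p"]) simp
  next
    fix k assume "k < v"
    assume "\<exists>r. r + r = r \<and> (\<forall>j\<in>{..<v}. map_uf (\<lambda>x. x j) r \<in> core) \<and>
        (\<forall>i\<in>H (Suc k). map_uf (row_form M i) r = p)"
    then obtain r where r: "r + r = r" "\<And>j. j < v \<Longrightarrow> map_uf (\<lambda>x. x j) r \<in> core"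
      "\<And>i. i \<in> H (Suc k) \<Longrightarrow> map_uf (row_form M i) r = p" by auto
    show "\<exists>r. r + r = r \<and> (\<forall>j\<in>{..<v}. map_uf (\<lambda>x. x j) r \<in> core) \<and>
        (\<forall>i\<in>H k. map_uf (row_form M i) r = p)"
    proof (rule ex_idempotent_solution[OF _ p(1)])
      show "row_form M i (x + y) = row_form M i x + row_form M i y" for i and x y :: "nat \<Rightarrow> 'a"
        by (simp add: row_form_def linear_form_add)
      fix A C assume A: "A \<in> \<A>" and C: "C \<in>\<^sub>u p"
      \<comment> \<open>The vectors \<open>w\<close> that already solve the rows starting after
        column \<open>k\<close>.\<close>
      define R where "R = (\<Inter>j<v. (\<lambda>x. x j) -` A) \<inter> (\<Inter>i\<in>H (Suc k). row_form M i -` C)"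
      have R: "R \<in>\<^sub>u r"
        unfolding R_def in_uf_Int_iff
      proof (intro conjI in_uf_INT)
        show "(\<lambda>x. x j) -` A \<in>\<^sub>u r" if "j \<in> {..<v}" for j
          using r(2) that A by (simp add: core_iff flip: in_map_uf_iff)
        show "row_form M i -` C \<in>\<^sub>u r" if "i \<in> H (Suc k)" for i
          using r(3)[OF that] C by (simp flip: in_map_uf_iff)
      qed (simp_all add: \<open>finite (H (Suc k))\<close>)
      show "\<exists>x. (\<forall>j\<in>{..<v}. x j \<in> A) \<and> (\<forall>i\<in>H k. row_form M i x \<in> C)"
      proof (cases "\<exists>i<u. first_col M i = k")
        case False
        \<comment> \<open>No row starts in column \<open>k\<close>, and any \<open>w\<close> in
          \<open>R\<close> serves unchanged.\<close>
        then have "H k = H (Suc k)" by (auto simp: H_def Suc_le_eq le_less)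
        with in_uf_nonempty[OF R] show ?thesis by (auto simp: R_def)
      next
        case True
        then obtain i\<^sub>0 where i\<^sub>0: "i\<^sub>0 < u" "first_col M i\<^sub>0 = k" by blast
        define c where "c = first_entry M i\<^sub>0"
        have c: "M $$ (i, k) = c" if "i < u" "first_col M i = k" for i
          using M(2) i\<^sub>0 that by (auto simp: first_entries_condition_def c_def first_entry_def)
        have "nmult c ` A \<in>\<^sub>u p"
          using i\<^sub>0 A by (intro pM) (auto simp: first_entries_def c_def)
        then have C': "C \<inter> nmult c ` A \<in>\<^sub>u p" using C by (simp add: in_uf_Int_iff)
        \<comment> \<open>Rows whose only nonzero entry is in column \<open>k\<close> are left out,
          as they have no remaining form \<open>f i\<close>; for them \<open>nmult c b\<close> in
          \<open>C\<close> is enough.\<close>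
        define J where "J = {i. i < u \<and> first_col M i = k \<and> support M i - {k} \<noteq> {}}"
        define f :: "nat \<Rightarrow> (nat \<Rightarrow> 'a) \<Rightarrow> 'a"
          where "f i = linear_form (\<lambda>j. M $$ (i, j)) (support M i - {k})" for i
        \<comment> \<open>Intersecting with the image of \<open>A\<close> under
          \<open>nmult c\<close> makes \<open>a\<close> equal to \<open>nmult c b\<close> with
          \<open>b\<close> in \<open>A\<close>, and \<open>b\<close> becomes coordinate
          \<open>k\<close> of the solution.\<close>
        have "\<exists>a\<in>C \<inter> nmult c ` A. \<exists>w\<in>R. \<forall>i\<in>J. a + f i w \<in> C \<inter> nmult c ` A"
        proof (rule central_sets[OF _ r(1) _ _ p C' R])
          show "f i (x + y) = f i x + f i y" for i x y by (simp add: f_def linear_form_add)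
          show "finite J" by (simp add: J_def)
          show "map_uf (f i) r \<in> core" if "i \<in> J" for i
            unfolding f_def using that r(2)
            by (intro map_linear_form_in_core) (auto simp: J_def support_def)
        qed
        then obtain b w where bw: "b \<in> A" "nmult c b \<in> C" "w \<in> R"
          "\<And>i. i \<in> J \<Longrightarrow> nmult c b + f i w \<in> C" by blast
        have "row_form M i (w(k := b)) \<in> C" if i: "i \<in> H k" for i
        proof (cases "first_col M i = k")
          case False
          \<comment> \<open>The support of this row lies to the right of \<open>k\<close>, so
            overwriting coordinate \<open>k\<close> does not change its value.\<close>
          then have "i \<in> H (Suc k)" using i by (simp add: H_def)
          then have "support M i \<noteq> {}" "k \<notin> support M i"
            using first_col_in_support[OF M(2), of i] first_col_le[of k M i]
            by (auto simp: H_def)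
          then have "row_form M i (w(k := b)) = row_form M i w"
            unfolding row_form_def by (intro linear_form_cong) auto
          then show ?thesis using bw(3) \<open>i \<in> H (Suc k)\<close> by (simp add: R_def)
        next
          case True
          have "i < u" using i by (simp add: H_def)
          then have supp: "support M i = insert k (support M i - {k})"
            using first_col_in_support[OF M(2), of i] True by auto
          show ?thesis
          proof (cases "support M i - {k} = {}")
            case True
            with supp have "support M i = {k}" by simp
            then show ?thesis
              using c[OF \<open>i < u\<close> \<open>first_col M i = k\<close>] bw(2)
              by (simp add: row_form_def linear_form_def ssum_singleton)
          next
            case False
            have "row_form M i (w(k := b)) =
                nmult c b + linear_form (\<lambda>j. M $$ (i, j)) (support M i - {k}) (w(k := b))"
              unfolding row_form_def linear_form_def
              by (subst supp, subst ssum_insert)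
                (use False c[OF \<open>i < u\<close> \<open>first_col M i = k\<close>] in auto)
            also have "linear_form (\<lambda>j. M $$ (i, j)) (support M i - {k}) (w(k := b)) = f i w"
              unfolding f_def using False by (intro linear_form_cong) auto
            finally have "row_form M i (w(k := b)) = nmult c b + f i w" .
            moreover have "i \<in> J" using False \<open>i < u\<close> \<open>first_col M i = k\<close> by (simp add: J_def)
            ultimately show ?thesis using bw(4) by simp
          qed
        qed
        moreover have "(w(k := b)) j \<in> A" if "j < v" for j
          using bw that by (simp add: R_def)
        ultimately show ?thesis by (intro exI[of _ "w(k := b)"]) auto
      qed
    qed
  qed simp
  then show ?thesis by (simp add: H_def lessThan_iff Ball_def)
qed

section \<open>From the idempotent on vectors to the sequences\<close>

theorem theorem18:
  fixes \<A> :: "'a::ab_semigroup_add set set"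
    and T :: "'a ultrafilter set"
    and u v :: nat
    and M :: "nat mat"
  assumes "u > 0" and "v > 0"
    and "M \<in> carrier_mat u v"
    and "first_entries_condition M"
    and "\<A> \<noteq> {}" and "{} \<notin> \<A>"
    and "\<forall>A\<in>\<A>. \<forall>B\<in>\<A>. A \<inter> B \<in> \<A>"
    and "\<forall>A\<in>\<A>. \<forall>a\<in>A. \<exists>B\<in>\<A>. a +o B \<subseteq> A"
    and "\<forall>A\<in>\<A>. \<exists>B\<in>\<A>. B + B \<subseteq> A"
    and "T = (\<Inter>A\<in>\<A>. cl A)"
  shows "subsemigroup T \<and>
    (\<forall>p (C :: nat \<Rightarrow> 'a set).
       p + p = p \<longrightarrow>
       p \<in> smallest_ideal T \<inter> (\<Inter>A\<in>\<A>. \<Inter>c\<in>first_entries M. cl (nmult c ` A)) \<longrightarrow>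
       (\<forall>n\<ge>1. C n \<in>\<^sub>u p) \<longrightarrow>
       (\<forall>A\<in>\<A>. \<exists>x :: nat \<Rightarrow> nat \<Rightarrow> 'a.
          (\<forall>j<v. \<forall>n\<ge>1. x j n \<in> A) \<and>
          (\<forall>F r. finite F \<longrightarrow> F \<noteq> {} \<longrightarrow> F \<subseteq> {1..} \<longrightarrow> r = Min F \<longrightarrow>
             mat_vec M (vec v (\<lambda>j. ssum (x j) F)) \<in> vec_power (C r) u)))"
proof -
  interpret neighbourhood_base \<A>
    using assms(5-9) by unfold_locales blast+
  have T: "T = core" using assms(10) by (simp add: core_def)
  have main: "\<exists>x :: nat \<Rightarrow> nat \<Rightarrow> 'a. (\<forall>j<v. \<forall>n\<ge>1. x j n \<in> A) \<and>
      (\<forall>F r. finite F \<longrightarrow> F \<noteq> {} \<longrightarrow> F \<subseteq> {1..} \<longrightarrow> r = Min F \<longrightarrow>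
         mat_vec M (vec v (\<lambda>j. ssum (x j) F)) \<in> vec_power (C r) u)"
    if p: "p + p = p" "p \<in> smallest_ideal core"
      and pM: "p \<in> (\<Inter>A\<in>\<A>. \<Inter>c\<in>first_entries M. cl (nmult c ` A))"
      and C: "\<forall>n\<ge>1. C n \<in>\<^sub>u p" and A: "A \<in> \<A>" for p A and C :: "nat \<Rightarrow> 'a set"
  proof -
    obtain r where r: "r + r = r" "\<And>j. j < v \<Longrightarrow> map_uf (\<lambda>x. x j) r \<in> core"
      "\<And>i. i < u \<Longrightarrow> map_uf (row_form M i) r = p"
      using ex_idempotent_matrix[OF assms(3,4) p] pM by (auto simp: cl_def)
    define D where "D n = (if n = 0 then UNIV
      else (\<Inter>j<v. (\<lambda>x. x j) -` A) \<inter> (\<Inter>i<u. row_form M i -` C n))" for n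
    have "D n \<in>\<^sub>u r" for n
      using r(2,3) A C by (auto simp: D_def in_uf_Int_iff core_iff simp flip: in_map_uf_iff
          intro!: in_uf_INT)
    then obtain x where x: "\<And>F. finite F \<Longrightarrow> F \<noteq> {} \<Longrightarrow> ssum x F \<in> D (Min F)"
      using idempotent_finite_sums[OF r(1)] by blast
    have "x n j \<in> A" if "j < v" "n \<ge> 1" for j n
      using x[of "{n}"] that by (auto simp: D_def ssum_singleton)
    moreover have "mat_vec M (vec v (\<lambda>j. ssum (\<lambda>n. x n j) F)) \<in> vec_power (C (Min F)) u"
      if F: "finite F" "F \<noteq> {}" "F \<subseteq> {1..}" for F
    proof -
      have "Min F \<in> F" using F by simp
      with F(3) have "Min F \<noteq> 0" by force
      then have *: "row_form M i (ssum x F) \<in> C (Min F)" if "i < u" for i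
        using x[OF F(1,2)] that by (simp add: D_def)
      \<comment> \<open>Vectors are summed pointwise in \<open>ssum x F\<close>, so by
        \<open>ssum_apply\<close> its coordinates are the sums of the individual sequences.\<close>
      have "ssum (\<lambda>j. nmult (M $$ (i, j)) (vec v (\<lambda>j. ssum (\<lambda>n. x n j) F) $ j))
          (support M i) = row_form M i (ssum x F)" if "i < u" for i
      proof -
        have "support M i \<noteq> {}"
          using first_col_in_support[OF assms(4), of i] assms(3) that by auto
        then show ?thesis
          unfolding row_form_def linear_form_def
          using F assms(3) by (intro ssum_cong) (auto simp: support_def ssum_apply)
      qed
      then have "mat_vec M (vec v (\<lambda>j. ssum (\<lambda>n. x n j) F)) = vec u (\<lambda>i. row_form M i (ssum x F))"
        unfolding mat_vec_def support_def using assms(3) by (intro eq_vecI) simp_all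
      then show ?thesis using * by (auto simp: vec_power_def vec_set_def)
    qed
    ultimately show ?thesis by (intro exI[of _ "\<lambda>j n. x n j"]) auto
  qed
  show ?thesis
    unfolding T
    by (intro conjI allI impI ballI subsemigroup_core) (rule main; auto)
qed

end
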